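(* Let an input graph with vertex set $S$ be given, with associated continued fraction algorithm $F$ (see context). Suppose that the conversion algorithm described in the context terminates on this input; let $V\subset S\times\mathcal M$ be the vertex set of the output graph ($\mathcal M$ a finite set of invertible $d\times d$ matrices). Then the output continued fraction algorithm $G$ on $\mathbb{R}_+^d\times V$ is well-defined, in the sense that for each $(i,I)\in V$ the cones $M\mathbb{R}_+^d$, over the outgoing edges $(i,I)\xrightarrow{M}(j,J)$, are pairwise Lebesgue-disjoint, and for every $n\in\mathbb N$, $$F^n\circ\phi=\phi\circ G^n\quad\text{almost everywhere (including equality of the domains of definition up to null sets),}$$ where $\phi:\mathbb{R}_+^d\times V\to\mathbb{R}_+^d\times S$ is defined by $\phi(x,i,I)=(Ix,i)$. Moreover, if the input graph satisfies $$\text{for every edge } i\xrightarrow{m,D}j:\qquad m^{-1}D\,\mathbb{R}_+^{c(D)}\subseteq\bigcup_{j\xrightarrow{m',D'}k}D'\,\mathbb{R}_+^{c(D')},$$ then the output graph is a matrices graph, up to removing vertices with the identity matrix (i.e. after removing suitable vertices of the form $(i,I_d)$).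
   Context: $\mathbb{R}_+=[0,\infty)$. "Lebesgue-disjoint" means that intersections have zero Lebesgue measure, and $\biguplus$ denotes a Lebesgue-disjoint union. Matrices graph: a finite directed graph with edges labeled by invertible $d\times d$ matrices such that, for each vertex $s$, if $\mathcal M_s$ is the set of labels of outgoing edges at $s$, then $\mathbb{R}_+^d=\bigcup_{m\in\mathcal M_s}m\mathbb{R}_+^d$ and the union is Lebesgue-disjoint (with one outgoing edge per label). Input graph: a finite directed graph with vertex set $S$ and edges $i\xrightarrow{m,D}j$, where $m\in M_d(\mathbb{R}_+)$ is invertible and $D$ is a non-negative matrix with $d$ rows and $c(D)$ columns such that $m^{-1}D$ is non-negative; for every $i\in S$ the union $\bigcup_{i\xrightarrow{m,D}j}D\mathbb{R}_+^{c(D)}$ over outgoing edges is assumed Lebesgue-disjoint. It defines a partial map $F:\mathbb{R}_+^d\times S\to\mathbb{R}_+^d\times S$ (up to null sets) by $F(x,i)=(m^{-1}x,j)$ if $i\xrightarrow{m,D}j$ is such that $x\in D\mathbb{R}_+^{c(D)}$. Conversion algorithm: start with an empty output graph and the set $\mathcal S=\{(i,I_d)\mid i\in S\}$, whose elements are marked as seen (they are vertices of the output graph). While $\mathcal S\neq\emptyset$: withdraw some $(i,I)$ from $\mathcal S$; for each input edge $i\xrightarrow{m,D}j$ such that the cone $D\mathbb{R}_+^{c(D)}\cap I\mathbb{R}_+^d$ has dimension $d$, choose a finite set $\mathcal J$ of invertible non-negative $d\times d$ matrices with $\biguplus_{J\in\mathcal J}J\mathbb{R}_+^d=m^{-1}(D\mathbb{R}_+^{c(D)}\cap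 I\mathbb{R}_+^d)$; for each $J\in\mathcal J$ add the edge $(i,I)\xrightarrow{I^{-1}mJ}(j,J)$ to the output graph, and if $(j,J)$ has not been seen, add it to $\mathcal S$ and mark it as seen. The matrices $J$ are normalized so that equal cones $J\mathbb{R}_+^d$ are represented by equal matrices (with $\mathbb{R}_+^d$ represented by $I_d$). The output continued fraction algorithm is the partial map $G$ on $\mathbb{R}_+^d\times V$ given by $G(x,i,I)=(M^{-1}x,j,J)$ if $(i,I)\xrightarrow{M}(j,J)$ is an edge of the output graph with $x\in M\mathbb{R}_+^d$. *)

theory Defs
  imports "HOL-Analysis.Analysis"
begin

definition orthant :: "(real^'d) set"
  where "orthant = {x. \<forall>k. 0 \<le> x $ k}"

definition nonneg_matrix :: "real^'d^'d \<Rightarrow> bool"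
  where "nonneg_matrix m \<longleftrightarrow> (\<forall>k l. 0 \<le> m $ k $ l)"

definition mat_cone :: "real^'d^'d \<Rightarrow> (real^'d) set"
  where "mat_cone M = (\<lambda>x. M *v x) ` orthant"

text \<open>A matrix D with d rows and an arbitrary number c(D) of columns is encoded as the list of
  its columns; then \<open>cols_cone D\<close> is the image of the orthant of dimension c(D) under D.\<close>

definition cols_cone :: "(real^'d) list \<Rightarrow> (real^'d) set"
  where "cols_cone D = {\<Sum>k<length D. a k *\<^sub>R (D ! k) | a :: nat \<Rightarrow> real. \<forall>k<length D. 0 \<le> a k}"

definition lebesgue_disjoint :: "(real^'d) set \<Rightarrow> (real^'d) set \<Rightarrow> bool"
  where "lebesgue_disjoint A B \<longleftrightarrow> A \<inter> B \<in> null_sets lebesgue"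


subsection \<open>Matrices graphs and input graphs\<close>

type_synonym ('w, 'd) edge = "'w \<times> (real^'d^'d) \<times> 'w"

type_synonym ('v, 'd) input_edge = "'v \<times> (real^'d^'d) \<times> (real^'d) list \<times> 'v"

definition labels :: "('w, 'd) edge set \<Rightarrow> 'w \<Rightarrow> (real^'d^'d) set"
  where "labels A s = {m. \<exists>t. (s, m, t) \<in> A}"

definition matrices_graph :: "'w set \<Rightarrow> ('w, 'd::finite) edge set \<Rightarrow> bool"
  where "matrices_graph V A \<longleftrightarrow>
    finite V \<and> finite A \<and>
    (\<forall>(s, m, t) \<in> A. s \<in> V \<and> t \<in> V \<and> invertible m) \<and>
    (\<forall>s \<in> V.
      orthant = (\<Union>m \<in> labels A s. mat_cone m) \<and>
      pairwise (\<lambda>m m'. lebesgue_disjoint (mat_cone m) (mat_cone m')) (labels A s) \<and>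
      (\<forall>m t t'. (s, m, t) \<in> A \<and> (s, m, t') \<in> A \<longrightarrow> t = t'))"

definition input_graph :: "'v set \<Rightarrow> ('v, 'd::finite) input_edge set \<Rightarrow> bool"
  where "input_graph S E \<longleftrightarrow>
    finite S \<and> finite E \<and>
    (\<forall>(i, m, D, j) \<in> E.
      i \<in> S \<and> j \<in> S \<and> nonneg_matrix m \<and> invertible m \<and>
      set D \<subseteq> orthant \<and> (\<lambda>x. matrix_inv m *v x) ` set D \<subseteq> orthant) \<and>
    (\<forall>i \<in> S.
      pairwise (\<lambda>(_, _, D, _) (_, _, D', _). lebesgue_disjoint (cols_cone D) (cols_cone D'))
        {e \<in> E. fst e = i})"

definition covering_input_graph :: "('v, 'd::finite) input_edge set \<Rightarrow> bool"
  where "covering_input_graph E \<longleftrightarrow>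
    (\<forall>(i, m, D, j) \<in> E.
      (\<lambda>x. matrix_inv m *v x) ` cols_cone D
        \<subseteq> \<Union> {cols_cone D' | m' D' k. (j, m', D', k) \<in> E})"


subsection \<open>Continued fraction maps\<close>

text \<open>A branch \<open>(i, m, C, j)\<close> sends \<open>(x, i)\<close> with \<open>x \<in> C\<close> to \<open>(m\<^sup>-\<^sup>1 x, j)\<close>. On overlaps of
  the cones, the rule may prescribe several values; the partial map is only determined up to null
  sets. Accordingly, \<open>cf_map V B F\<close> says that \<open>F\<close> is any one of the representatives of this
  almost-everywhere defined partial map (\<open>None\<close> meaning undefined).\<close>

definition cf_map ::
  "'w set \<Rightarrow> ('w \<times> (real^'d^'d) \<times> (real^'d) set \<times> 'w) set
    \<Rightarrow> ((real^'d::finite) \<times> 'w \<rightharpoonup> (real^'d) \<times> 'w) \<Rightarrow> bool"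
  where "cf_map V B F \<longleftrightarrow>
    (\<forall>i \<in> V. AE x in lebesgue. x \<in> orthant \<longrightarrow>
      (\<forall>m C j. (i, m, C, j) \<in> B \<and> x \<in> C \<longrightarrow> F (x, i) = Some (matrix_inv m *v x, j)) \<and>
      ((\<nexists>m C j. (i, m, C, j) \<in> B \<and> x \<in> C) \<longrightarrow> F (x, i) = None))"

definition input_branches ::
  "('v, 'd) input_edge set \<Rightarrow> ('v \<times> (real^'d^'d) \<times> (real^'d) set \<times> 'v) set"
  where "input_branches E = (\<lambda>(i, m, D, j). (i, m, cols_cone D, j)) ` E"

definition output_branches ::
  "('w, 'd) edge set \<Rightarrow> ('w \<times> (real^'d^'d) \<times> (real^'d) set \<times> 'w) set"
  where "output_branches A = (\<lambda>(v, M, w). (v, M, mat_cone M, w)) ` A"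

definition map_power :: "('a \<rightharpoonup> 'a) \<Rightarrow> nat \<Rightarrow> ('a \<rightharpoonup> 'a)"
  where "map_power F n = ((\<lambda>H. F \<circ>\<^sub>m H) ^^ n) Some"

definition phi :: "(real^'d) \<times> 'v \<times> (real^'d^'d) \<Rightarrow> (real^'d) \<times> 'v"
  where "phi = (\<lambda>(x, i, I). (I *v x, i))"

text \<open>Representatives exist as soon as the cones of the branches at each vertex are
  Lebesgue-disjoint.\<close>

lemma cf_map_exists:
  fixes B :: "('w \<times> (real^'d::finite^'d) \<times> (real^'d) set \<times> 'w) set"
  assumes fin: "finite B"
    and disj: "\<And>i. i \<in> V \<Longrightarrow>
      pairwise (\<lambda>(_, _, C, _) (_, _, C', _). lebesgue_disjoint C C') {b \<in> B. fst b = i}"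
  shows "\<exists>F. cf_map V B F"
proof -
  define val :: "(real^'d) \<Rightarrow> ('w \<times> (real^'d^'d) \<times> (real^'d) set \<times> 'w) \<Rightarrow> (real^'d) \<times> 'w"
    where "val = (\<lambda>x (i, m, C, j). (matrix_inv m *v x, j))"
  define act where "act = (\<lambda>(x, i). {b \<in> B. fst b = i \<and> x \<in> fst (snd (snd b))})"
  define F where "F = (\<lambda>(x, i). if act (x, i) = {} then None
    else Some (val x (SOME b. b \<in> act (x, i))))"
  have "AE x in lebesgue. x \<in> orthant \<longrightarrow>
      (\<forall>m C j. (i, m, C, j) \<in> B \<and> x \<in> C \<longrightarrow> F (x, i) = Some (matrix_inv m *v x, j)) \<and>
      ((\<nexists>m C j. (i, m, C, j) \<in> B \<and> x \<in> C) \<longrightarrow> F (x, i) = None)" if i: "i \<in> V" for i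
  proof -
    define P where "P = {(b, b'). b \<in> B \<and> b' \<in> B \<and> fst b = i \<and> fst b' = i \<and> b \<noteq> b'}"
    define Z where "Z = (\<Union>p \<in> P. fst (snd (snd (fst p))) \<inter> fst (snd (snd (snd p))))"
    have "finite P"
      by (rule finite_subset[of _ "B \<times> B"]) (auto simp: P_def fin)
    moreover have "fst (snd (snd b)) \<inter> fst (snd (snd b')) \<in> null_sets lebesgue"
      if "(b, b') \<in> P" for b b'
    proof -
      have "(\<lambda>(_, _, C, _) (_, _, C', _). lebesgue_disjoint C C') b b'"
        by (rule pairwiseD[OF disj[OF i]]) (use that in \<open>simp_all add: P_def\<close>)
      then show ?thesis by (simp add: lebesgue_disjoint_def split: prod.splits)
    qed
    ultimately have Z: "Z \<in> null_sets lebesgue"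
      unfolding Z_def by (intro null_sets_UN' countable_finite) simp_all
    have uniq: "b = b'" if "x \<notin> Z" "b \<in> act (x, i)" "b' \<in> act (x, i)" for x b b'
    proof (rule ccontr)
      assume "b \<noteq> b'"
      with that have "(b, b') \<in> P" "x \<in> fst (snd (snd b)) \<inter> fst (snd (snd b'))"
        by (simp_all add: P_def act_def)
      then have "x \<in> Z" unfolding Z_def by (intro UN_I[of "(b, b')"]) simp_all
      with that show False by simp
    qed
    have "(\<forall>m C j. (i, m, C, j) \<in> B \<and> x \<in> C \<longrightarrow> F (x, i) = Some (matrix_inv m *v x, j)) \<and>
      ((\<nexists>m C j. (i, m, C, j) \<in> B \<and> x \<in> C) \<longrightarrow> F (x, i) = None)" if x: "x \<notin> Z" for x
    proof (intro conjI allI impI)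
      fix m C j assume "(i, m, C, j) \<in> B \<and> x \<in> C"
      then have a: "(i, m, C, j) \<in> act (x, i)" by (simp add: act_def)
      then have "(SOME b. b \<in> act (x, i)) = (i, m, C, j)"
        by (intro some_equality) (rule a, rule uniq[OF x])
      then show "F (x, i) = Some (matrix_inv m *v x, j)"
        using a by (auto simp: F_def val_def)
    next
      assume "\<nexists>m C j. (i, m, C, j) \<in> B \<and> x \<in> C"
      then show "F (x, i) = None" by (auto simp: F_def act_def)
    qed
    then show ?thesis by (intro eventually_mono[OF AE_not_in[OF Z]] impI)
  qed
  then show ?thesis unfolding cf_map_def by blast
qed


subsection \<open>The conversion algorithm\<close>

text \<open>The matrices the algorithm may use as representatives of simplicial cones.\<close>

definition normalization :: "(real^'d::finite^'d) set \<Rightarrow> bool"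
  where "normalization \<N> \<longleftrightarrow> mat 1 \<in> \<N> \<and> inj_on mat_cone \<N>"

definition active_edges ::
  "('v, 'd::finite) input_edge set \<Rightarrow> 'v \<Rightarrow> real^'d^'d \<Rightarrow> ('v, 'd) input_edge set"
  where "active_edges E i I =
    {(i', m, D, j) \<in> E. i' = i \<and> dim (cols_cone D \<inter> mat_cone I) = CARD('d)}"

definition decomposition ::
  "(real^'d::finite^'d) set \<Rightarrow> (real^'d) set \<Rightarrow> (real^'d^'d) set \<Rightarrow> bool"
  where "decomposition \<N> C \<J> \<longleftrightarrow>
    finite \<J> \<and> \<J> \<subseteq> \<N> \<and> (\<forall>J \<in> \<J>. invertible J \<and> nonneg_matrix J) \<and>
    (\<Union>J \<in> \<J>. mat_cone J) = C \<and>
    pairwise (\<lambda>J J'. lebesgue_disjoint (mat_cone J) (mat_cone J')) \<J>"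

text \<open>A state consists of the set of pending vertices, the set of seen vertices (those of the
  output graph so far) and the set of output edges. One step is one pass through the loop; the
  withdrawn vertex and, for each active edge \<open>e\<close>, the decomposition \<open>\<J> e\<close> are arbitrary.\<close>

type_synonym ('v, 'd) conv_state =
  "('v \<times> (real^'d^'d)) set \<times> ('v \<times> (real^'d^'d)) set \<times> ('v \<times> (real^'d^'d), 'd) edge set"

definition conv_init :: "'v set \<Rightarrow> ('v, 'd::finite) conv_state"
  where "conv_init S = (S \<times> {mat 1}, S \<times> {mat 1}, {})"

inductive conv_step ::
  "('v, 'd::finite) input_edge set \<Rightarrow> (real^'d^'d) set
    \<Rightarrow> ('v, 'd) conv_state \<Rightarrow> ('v, 'd) conv_state \<Rightarrow> bool"
  for E \<N>
  where
    "\<lbrakk>(i, I) \<in> P;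
      \<forall>(i', m, D, j) \<in> active_edges E i I.
        decomposition \<N> ((\<lambda>x. matrix_inv m *v x) ` (cols_cone D \<inter> mat_cone I)) (\<J> (i', m, D, j));
      new = {((i, I), matrix_inv I ** m ** J, (j, J)) | m D j J.
        (i, m, D, j) \<in> active_edges E i I \<and> J \<in> \<J> (i, m, D, j)};
      T = (\<lambda>(_, _, w). w) ` new\<rbrakk>
    \<Longrightarrow> conv_step E \<N> (P, V, A) (P - {(i, I)} \<union> (T - V), V \<union> T, A \<union> new)"

text \<open>Some run of the algorithm ends with the output graph with vertices \<open>V\<close> and edges \<open>A\<close>.\<close>

definition conversion_output ::
  "'v set \<Rightarrow> ('v, 'd::finite) input_edge set \<Rightarrow> (real^'d^'d) set
    \<Rightarrow> ('v \<times> (real^'d^'d)) set \<Rightarrow> ('v \<times> (real^'d^'d), 'd) edge set \<Rightarrow> bool"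
  where "conversion_output S E \<N> V A \<longleftrightarrow>
    (conv_step E \<N>)\<^sup>*\<^sup>* (conv_init S) ({}, V, A)"

end

theory Submission
  imports Defs
begin

text \<open>
  A vertex \<open>(i, I)\<close> is expanded exactly once, and the cones of its outgoing edges
  \<open>I\<^sup>-\<^sup>1 m J\<close> are the preimages under \<open>I\<close> of the pieces \<open>m J\<close> of \<open>D \<inter> I\<close>. Hence they are
  disjoint up to null sets, they fill the preimage of the domain of \<open>F\<close> at \<open>i\<close> up to the
  lower-dimensional intersections that the algorithm skips, and on each of them
  \<open>J M\<^sup>-\<^sup>1 = m\<^sup>-\<^sup>1 I\<close>, which is the case \<open>n = 1\<close> of the conjugacy. The general case follows by
  writing \<open>F\<^sup>n\<^sup>+\<^sup>1 = F\<^sup>n \<circ> F\<close> and pulling null sets back along the finitely many invertible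
  branches of \<open>G\<close>. Under the covering hypothesis, every vertex that is the target of some edge
  has its whole orthant covered up to a null set by finitely many closed cones, hence covered;
  the vertices without incoming edge are initial ones and are the ones removed.
\<close>

subsection \<open>Invertible matrices, cones and null sets\<close>

lemma matrix_inv_left_right:
  fixes M :: "real^'d^'d"
  assumes "invertible M"
  shows matrix_inv_left: "matrix_inv M ** M = mat 1"
    and matrix_inv_right: "M ** matrix_inv M = mat 1"
proof -
  obtain M' where "M ** M' = mat 1 \<and> M' ** M = mat 1"
    using assms by (auto simp: invertible_def)
  then have "M ** matrix_inv M = mat 1 \<and> matrix_inv M ** M = mat 1"
    unfolding matrix_inv_def by (rule someI)
  then show "matrix_inv M ** M = mat 1" "M ** matrix_inv M = mat 1" by auto
qed

lemma matrix_inv_vector: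
  fixes M :: "real^'d^'d"
  assumes "invertible M"
  shows matrix_inv_vector_left: "matrix_inv M *v (M *v x) = x"
    and matrix_inv_vector_right: "M *v (matrix_inv M *v x) = x"
  by (simp_all add: matrix_vector_mul_assoc matrix_inv_left_right assms)

lemma invertible_matrix_inv:
  fixes M :: "real^'d^'d"
  shows "invertible M \<Longrightarrow> invertible (matrix_inv M)"
  unfolding invertible_def[of "matrix_inv M"]
  using matrix_inv_left matrix_inv_right by blast

lemma inj_matrix_vector:
  fixes M :: "real^'d^'d"
  shows "invertible M \<Longrightarrow> inj (\<lambda>x. M *v x)"
  by (rule inj_on_inverseI) (rule matrix_inv_vector_left)

lemma matrix_inv_vector_mem_image_iff:
  fixes M :: "real^'d^'d"
  assumes "invertible M"
  shows "matrix_inv M *v x \<in> (\<lambda>x. matrix_inv M *v x) ` C \<longleftrightarrow> x \<in> C"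
  by (rule inj_image_mem_iff[OF inj_matrix_vector[OF invertible_matrix_inv[OF assms]]])

lemma mem_mat_cone_mult_iff:
  fixes M N :: "real^'d^'d"
  assumes "invertible M"
  shows "x \<in> mat_cone (M ** N) \<longleftrightarrow> matrix_inv M *v x \<in> mat_cone N"
  unfolding mat_cone_def image_iff matrix_vector_mul_assoc[symmetric]
  using matrix_inv_vector[OF assms] by metis

lemma mem_mat_cone_iff:
  fixes M :: "real^'d^'d"
  assumes "invertible M"
  shows "x \<in> mat_cone M \<longleftrightarrow> matrix_inv M *v x \<in> orthant"
  using mem_mat_cone_mult_iff[OF assms, of x "mat 1"] by (simp add: mat_cone_def)

text \<open>The matrix \<open>I^-1 m\<close> carries the cone of \<open>J\<close> bijectively onto
  the cone of the edge, so its inverse \<open>m^-1 I\<close> tests membership. Through this,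
  questions about output cones become questions about the pieces \<open>J\<close>.\<close>

lemma mem_mat_cone_edge_iff:
  fixes I m J :: "real^'d^'d"
  assumes "invertible I" "invertible m"
  shows "x \<in> mat_cone (matrix_inv I ** m ** J) \<longleftrightarrow> matrix_inv m *v (I *v x) \<in> mat_cone J"
proof -
  have "x \<in> mat_cone (matrix_inv I ** m ** J) \<longleftrightarrow> I *v x \<in> mat_cone (m ** J)"
    using matrix_inv_vector[OF assms(1)]
    unfolding mat_cone_def image_iff matrix_vector_mul_assoc[symmetric] by metis
  then show ?thesis by (simp add: mem_mat_cone_mult_iff assms)
qed

lemma nonneg_matrix_orthant:
  fixes M :: "real^'d::finite^'d"
  shows "nonneg_matrix M \<Longrightarrow> x \<in> orthant \<Longrightarrow> M *v x \<in> orthant"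
  by (auto simp: nonneg_matrix_def orthant_def matrix_vector_mult_def intro!: sum_nonneg)

section \<open>Topology of the orthant and of simplicial cones\<close>

lemma closed_orthant: "closed (orthant :: (real^'d::finite) set)"
  unfolding orthant_def by (intro closed_Collect_all closed_Collect_le continuous_intros)

lemma convex_orthant: "convex (orthant :: (real^'d::finite) set)"
  by (auto simp: orthant_def convex_def)

lemma interior_orthant_nonempty: "interior (orthant :: (real^'d::finite) set) \<noteq> {}"
proof -
  have "open {x :: real^'d. \<forall>k. 0 < x $ k}"
    unfolding Collect_all_eq by (intro open_INT ballI finite open_Collect_less continuous_intros)
  moreover have "{x :: real^'d. \<forall>k. 0 < x $ k} \<subseteq> orthant"
    by (auto simp: orthant_def less_imp_le)
  moreover have "(\<chi> k. 1) \<in> {x :: real^'d. \<forall>k. 0 < x $ k}" by simp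
  ultimately have "(\<chi> k. 1) \<in> interior (orthant :: (real^'d) set)" by (meson interiorI)
  then show ?thesis by blast
qed

lemma closed_mat_cone:
  fixes M :: "real^'d::finite^'d"
  assumes "invertible M"
  shows "closed (mat_cone M)"
  unfolding mat_cone_def
  by (rule closed_injective_linear_image[OF closed_orthant _ inj_matrix_vector[OF assms]]) simp

section \<open>Null sets under invertible matrices\<close>

lemma AE_lebesgue_iff_negligible:
  "(AE x in lebesgue. P x) \<longleftrightarrow> negligible {x :: 'a::euclidean_space. \<not> P x}"
  by (auto simp: completion.AE_iff_null_sets negligible_iff_null_sets)

lemma negligible_matrix_image:
  fixes M :: "real^'d::finite^'d"
  assumes "negligible N"
  shows "negligible ((\<lambda>x. M *v x) ` N)"
  by (rule negligible_differentiable_image_negligible[OF _ assms])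
    (auto intro!: differentiable_on_subset[OF linear_imp_differentiable_on])

lemma negligible_matrix_vimage:
  fixes M :: "real^'d::finite^'d"
  assumes "invertible M" "negligible N"
  shows "negligible {x. M *v x \<in> N}"
  by (rule negligible_subset[OF negligible_matrix_image[OF assms(2), of "matrix_inv M"]])
    (use matrix_inv_vector_left[OF assms(1)] in \<open>auto simp: image_iff intro!: bexI[rotated]\<close>)

text \<open>Serves to pull exceptional sets back: along \<open>I\<close> for that of
  \<open>F\<close>, and along \<open>M^-1\<close> for that of the \<open>n\<close>-th powers at the
  target of an edge.\<close>

lemma AE_lebesgue_matrix:
  fixes M :: "real^'d::finite^'d"
  assumes "invertible M" "AE x in lebesgue. P x"
  shows "AE x in lebesgue. P (M *v x)"
  using negligible_matrix_vimage[OF assms(1), of "{x. \<not> P x}"] assms(2)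
  by (simp add: AE_lebesgue_iff_negligible)

lemma lebesgue_disjoint_iff_negligible:
  "lebesgue_disjoint A B \<longleftrightarrow> negligible (A \<inter> B)"
  by (simp add: lebesgue_disjoint_def negligible_iff_null_sets)

text \<open>The preimage of the cone under \<open>M\<close> contains the interior of the orthant, a
  nonempty open set. This later forbids two edges with one label and different targets.\<close>

lemma mat_cone_not_negligible:
  fixes M :: "real^'d::finite^'d"
  assumes "invertible M"
  shows "\<not> negligible (mat_cone M)"
proof
  assume "negligible (mat_cone M)"
  then have "negligible {x. M *v x \<in> mat_cone M}"
    by (rule negligible_matrix_vimage[OF assms])
  then have "negligible (interior (orthant :: (real^'d) set))"
    by (rule negligible_subset) (use interior_subset in \<open>force simp: mat_cone_def\<close>)
  then show False
    using interior_orthant_nonempty open_not_negligible[OF open_interior] by blast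
qed

text \<open>The interior of the orthant minus \<open>U\<close> is open and null, hence empty; and a
  closed convex set with interior points is the closure of its interior.\<close>

lemma orthant_subset_closed:
  fixes U :: "(real^'d::finite) set"
  assumes "closed U" and ae: "AE x in lebesgue. x \<in> orthant \<longrightarrow> x \<in> U"
  shows "orthant \<subseteq> U"
proof -
  have "negligible (interior orthant - U)"
    by (rule negligible_subset[OF ae[unfolded AE_lebesgue_iff_negligible]])
      (use interior_subset in auto)
  then have "interior orthant \<subseteq> U"
    using open_not_negligible[of "interior orthant - U"] \<open>closed U\<close>
    by (auto simp: open_Diff)
  then have "closure (interior orthant) \<subseteq> U"
    using \<open>closed U\<close> by (rule closure_minimal)
  then show ?thesis
    using convex_closure_interior[OF convex_orthant interior_orthant_nonempty] closed_orthant
    by (metis closure_closed)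
qed

subsection \<open>Expanding one vertex\<close>

text \<open>These are the edges \<open>new\<close> of one \<open>conv_step\<close>, with the choice
  of decompositions hidden by a quantifier so that the property can be kept through the later states
  of a run.\<close>

definition expansion ::
  "('v, 'd::finite) input_edge set \<Rightarrow> (real^'d^'d) set \<Rightarrow> 'v \<Rightarrow> real^'d^'d
    \<Rightarrow> ('v \<times> (real^'d^'d), 'd) edge set \<Rightarrow> bool"
  where "expansion E \<N> i I X \<longleftrightarrow> (\<exists>\<J>.
    (\<forall>(i', m, D, j) \<in> active_edges E i I.
      decomposition \<N> ((\<lambda>x. matrix_inv m *v x) ` (cols_cone D \<inter> mat_cone I)) (\<J> (i', m, D, j))) \<and>
    X = {((i, I), matrix_inv I ** m ** J, (j, J)) | m D j J.
      (i, m, D, j) \<in> active_edges E i I \<and> J \<in> \<J> (i, m, D, j)})"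

lemma active_edges_mem:
  "(i', m, D, j) \<in> active_edges E i I \<longleftrightarrow>
    (i', m, D, j) \<in> E \<and> i' = i \<and> dim (cols_cone D \<inter> mat_cone I) = CARD('d)"
  for E :: "('v, 'd::finite) input_edge set"
  by (auto simp: active_edges_def)

lemma finite_expansion:
  assumes "finite E" "expansion E \<N> i I X"
  shows "finite X"
proof -
  obtain \<J> where dec: "\<forall>(i', m, D, j) \<in> active_edges E i I.
      decomposition \<N> ((\<lambda>x. matrix_inv m *v x) ` (cols_cone D \<inter> mat_cone I)) (\<J> (i', m, D, j))"
    and X: "X = {((i, I), matrix_inv I ** m ** J, (j, J)) | m D j J.
      (i, m, D, j) \<in> active_edges E i I \<and> J \<in> \<J> (i, m, D, j)}"
    using assms(2) unfolding expansion_def by blast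
  have "X \<subseteq> (\<lambda>((_, m, _, j), J). ((i, I), matrix_inv I ** m ** J, (j, J))) `
      (SIGMA e : active_edges E i I. \<J> e)"
    unfolding X by (force simp: image_iff)
  moreover have "finite (active_edges E i I)"
    by (rule finite_subset[OF _ assms(1)]) (auto simp: active_edges_def)
  moreover have "finite (\<J> e)" if "e \<in> active_edges E i I" for e
    using dec that by (auto simp: decomposition_def)
  ultimately show ?thesis
    by (meson finite_SigmaI finite_imageI finite_subset)
qed

text \<open>Traces an output edge back to the input edge it comes from. In the final inclusion, the
  \<open>D\<close> part serves the domain of \<open>F\<close> and the covering hypothesis, the
  \<open>I\<close> part keeps the cone of \<open>M\<close> inside the orthant.\<close>

lemma expansion_edge:
  fixes E :: "('v, 'd::finite) input_edge set"
  assumes "input_graph S E" "expansion E \<N> i I X" "invertible I" "(v, M, (j, J)) \<in> X"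
  obtains m D where "v = (i, I)" "M = matrix_inv I ** m ** J" "(i, m, D, j) \<in> E" "j \<in> S"
    "invertible m" "J \<in> \<N>" "invertible J" "nonneg_matrix J" "invertible M"
    "mat_cone J \<subseteq> (\<lambda>x. matrix_inv m *v x) ` (cols_cone D \<inter> mat_cone I)"
proof -
  obtain m D \<J> where e: "v = (i, I)" "M = matrix_inv I ** m ** J" "(i, m, D, j) \<in> active_edges E i I"
    and J: "J \<in> \<J> (i, m, D, j)"
    and dec: "decomposition \<N> ((\<lambda>x. matrix_inv m *v x) ` (cols_cone D \<inter> mat_cone I)) (\<J> (i, m, D, j))"
    using assms(2,4) unfolding expansion_def by blast
  have E: "(i, m, D, j) \<in> E" using e by (simp add: active_edges_mem)
  then have mj: "invertible m" "j \<in> S"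
    using assms(1) by (auto simp: input_graph_def)
  have J': "J \<in> \<N>" "invertible J" "nonneg_matrix J"
    "mat_cone J \<subseteq> (\<lambda>x. matrix_inv m *v x) ` (cols_cone D \<inter> mat_cone I)"
    using J dec by (auto simp: decomposition_def)
  have "invertible M"
    unfolding e using mj J' assms(3) by (intro invertible_mult invertible_matrix_inv)
  with e E mj J' show ?thesis using that by blast
qed

text \<open>Semiconjugacy at a single point: \<open>I M = m J\<close> yields
  \<open>J M^-1 = m^-1 I\<close>, so \<open>phi\<close> sends the image of \<open>x\<close> along
  the output edge to the image of \<open>phi (x, i, I)\<close> along the input edge.\<close>

lemma expansion_edge_value:
  fixes E :: "('v, 'd::finite) input_edge set"
  assumes "input_graph S E" "expansion E \<N> i I X" "invertible I" "(v, M, (j, J)) \<in> X"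
    and x: "x \<in> mat_cone M"
  obtains m D where "(i, m, D, j) \<in> E" "I *v x \<in> cols_cone D"
    "J *v (matrix_inv M *v x) = matrix_inv m *v (I *v x)"
proof (rule expansion_edge[OF assms(1-4)])
  fix m D assume M: "M = matrix_inv I ** m ** J" and E: "(i, m, D, j) \<in> E"
    and inv: "invertible m" "invertible J" "invertible M"
    and sub: "mat_cone J \<subseteq> (\<lambda>x. matrix_inv m *v x) ` (cols_cone D \<inter> mat_cone I)"
  have "matrix_inv m *v (I *v x) \<in> mat_cone J"
    using x unfolding M by (simp add: mem_mat_cone_edge_iff inv assms(3))
  then have "I *v x \<in> cols_cone D"
    using sub matrix_inv_vector_mem_image_iff[OF inv(1)] by blast
  \<comment> \<open>Expand \<open>M\<close> in \<open>x = M (M^-1 x)\<close>; applying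
    \<open>I\<close> and then \<open>m^-1\<close> isolates \<open>J M^-1 x\<close>.\<close>
  moreover have "x = matrix_inv I *v (m *v (J *v (matrix_inv M *v x)))"
    using matrix_inv_vector_right[OF inv(3), of x]
    by (simp add: M matrix_vector_mul_assoc matrix_mul_assoc)
  then have "I *v x = m *v (J *v (matrix_inv M *v x))"
    using matrix_inv_vector_right[OF assms(3)] by metis
  then have "J *v (matrix_inv M *v x) = matrix_inv m *v (I *v x)"
    by (simp add: matrix_inv_vector_left inv(1))
  ultimately show ?thesis using that E by blast
qed

text \<open>Two edges come either from one input edge, where the pieces \<open>J\<close> are
  disjoint and are pulled back along \<open>m^-1 I\<close>, or from two, where the cones of
  \<open>D\<close> and \<open>D'\<close> are disjoint and are pulled back along \<open>I\<close>.
  Edges are compared rather than matrices, so that parallel edges with one label can be excluded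
  too.\<close>

lemma expansion_disjoint:
  fixes E :: "('v, 'd::finite) input_edge set"
  assumes "input_graph S E" "i \<in> S" "expansion E \<N> i I X" "invertible I"
  shows "pairwise (\<lambda>(_, M, _) (_, M', _). lebesgue_disjoint (mat_cone M) (mat_cone M')) X"
proof (rule pairwiseI)
  fix e e' assume e: "e \<in> X" "e' \<in> X" "e \<noteq> e'"
  obtain \<J> where dec: "\<forall>(i', m, D, j) \<in> active_edges E i I.
      decomposition \<N> ((\<lambda>x. matrix_inv m *v x) ` (cols_cone D \<inter> mat_cone I)) (\<J> (i', m, D, j))"
    and X: "X = {((i, I), matrix_inv I ** m ** J, (j, J)) | m D j J.
      (i, m, D, j) \<in> active_edges E i I \<and> J \<in> \<J> (i, m, D, j)}"
    using assms(3) unfolding expansion_def by blast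
  obtain m D j J where 1: "e = ((i, I), matrix_inv I ** m ** J, (j, J))"
    "(i, m, D, j) \<in> active_edges E i I" "J \<in> \<J> (i, m, D, j)"
    using e X by blast
  obtain m' D' j' J' where 2: "e' = ((i, I), matrix_inv I ** m' ** J', (j', J'))"
    "(i, m', D', j') \<in> active_edges E i I" "J' \<in> \<J> (i, m', D', j')"
    using e X by blast
  have E: "(i, m, D, j) \<in> E" "(i, m', D', j') \<in> E"
    using 1 2 by (auto simp: active_edges_mem)
  have inv: "invertible m" "invertible m'"
    using E assms(1) by (auto simp: input_graph_def)
  have d1: "decomposition \<N> ((\<lambda>x. matrix_inv m *v x) ` (cols_cone D \<inter> mat_cone I)) (\<J> (i, m, D, j))"
    and d2: "decomposition \<N> ((\<lambda>x. matrix_inv m' *v x) ` (cols_cone D' \<inter> mat_cone I)) (\<J> (i, m', D', j'))"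
    using dec 1 2 by auto
  have "negligible (mat_cone (matrix_inv I ** m ** J) \<inter> mat_cone (matrix_inv I ** m' ** J'))"
  proof (cases "(i, m, D, j) = (i, m', D', j')")
    case True
    \<comment> \<open>One input edge fixes \<open>m\<close> and \<open>j\<close>, so distinct edges
      over it need distinct pieces.\<close>
    then have "J \<noteq> J'" using 1 2 e by auto
    then have "negligible (mat_cone J \<inter> mat_cone J')"
      using d1 1 2 True
      by (auto simp: decomposition_def pairwise_def lebesgue_disjoint_iff_negligible)
    then have "negligible {x. (matrix_inv m ** I) *v x \<in> mat_cone J \<inter> mat_cone J'}"
      by (intro negligible_matrix_vimage invertible_mult invertible_matrix_inv inv assms)
    then show ?thesis
      by (rule negligible_subset)
        (use True inv assms(4) in \<open>auto simp: mem_mat_cone_edge_iff matrix_vector_mul_assoc[symmetric]\<close>)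
  next
    case False
    have "pairwise (\<lambda>(_, _, D, _) (_, _, D', _). lebesgue_disjoint (cols_cone D) (cols_cone D'))
        {e \<in> E. fst e = i}"
      using assms(1,2) by (auto simp: input_graph_def)
    from pairwiseD[OF this _ _ False] have "negligible (cols_cone D \<inter> cols_cone D')"
      using E by (simp add: lebesgue_disjoint_iff_negligible)
    then have "negligible {x. I *v x \<in> cols_cone D \<inter> cols_cone D'}"
      by (rule negligible_matrix_vimage[OF assms(4)])
    moreover have "I *v x \<in> cols_cone D" if "x \<in> mat_cone (matrix_inv I ** m ** J)" for x
    proof -
      have "matrix_inv m *v (I *v x) \<in> (\<lambda>x. matrix_inv m *v x) ` (cols_cone D \<inter> mat_cone I)"
        using that d1 1 by (auto simp: mem_mat_cone_edge_iff assms inv decomposition_def)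
      then show ?thesis
        by (simp add: matrix_inv_vector_mem_image_iff inv)
    qed
    moreover have "I *v x \<in> cols_cone D'" if "x \<in> mat_cone (matrix_inv I ** m' ** J')" for x
    proof -
      have "matrix_inv m' *v (I *v x) \<in> (\<lambda>x. matrix_inv m' *v x) ` (cols_cone D' \<inter> mat_cone I)"
        using that d2 2 by (auto simp: mem_mat_cone_edge_iff assms inv decomposition_def)
      then show ?thesis
        by (simp add: matrix_inv_vector_mem_image_iff inv)
    qed
    ultimately show ?thesis
      by (elim negligible_subset) auto
  qed
  then show "(\<lambda>(_, M, _) (_, M', _). lebesgue_disjoint (mat_cone M) (mat_cone M')) e e'"
    by (simp add: 1 2 lebesgue_disjoint_iff_negligible)
qed

text \<open>Inactive input edges meet the cone of \<open>I\<close> in a set of dimension less than \<open>d\<close>, hence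
  in a null set.\<close>

lemma expansion_covers:
  fixes E :: "('v, 'd::finite) input_edge set"
  assumes "input_graph S E" "expansion E \<N> i I X" "invertible I"
  shows "AE x in lebesgue. x \<in> orthant \<longrightarrow>
    (\<forall>m D j. (i, m, D, j) \<in> E \<and> I *v x \<in> cols_cone D \<longrightarrow>
      (\<exists>v M w. (v, M, w) \<in> X \<and> x \<in> mat_cone M))"
proof -
  obtain \<J> where dec: "\<forall>(i', m, D, j) \<in> active_edges E i I.
      decomposition \<N> ((\<lambda>x. matrix_inv m *v x) ` (cols_cone D \<inter> mat_cone I)) (\<J> (i', m, D, j))"
    and X: "X = {((i, I), matrix_inv I ** m ** J, (j, J)) | m D j J.
      (i, m, D, j) \<in> active_edges E i I \<and> J \<in> \<J> (i, m, D, j)}"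
    using assms(2) unfolding expansion_def by blast
  define K where "K = {(i', m, D, j) \<in> E. dim (cols_cone D \<inter> mat_cone I) < CARD('d)}"
  define Z where "Z = (\<Union>(i', m, D, j) \<in> K. cols_cone D \<inter> mat_cone I)"
  have "negligible Z"
    unfolding Z_def
  proof (rule negligible_Union)
    have "finite E" using assms(1) by (simp add: input_graph_def)
    then have "finite K" by (rule rev_finite_subset) (auto simp: K_def)
    then show "finite ((\<lambda>(i', m, D, j). cols_cone D \<inter> mat_cone I) ` K)" by simp
  qed (auto simp: K_def intro: negligible_lowdim)
  then have "AE x in lebesgue. I *v x \<notin> Z"
    using negligible_matrix_vimage[OF assms(3)] by (simp add: AE_lebesgue_iff_negligible)
  then show ?thesis
  proof (rule eventually_mono, intro impI allI, elim conjE)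
    fix x m D j
    assume x: "I *v x \<notin> Z" "x \<in> orthant" and E: "(i, m, D, j) \<in> E" and D: "I *v x \<in> cols_cone D"
    have I: "I *v x \<in> mat_cone I" using x by (simp add: mat_cone_def)
    have inv: "invertible m" using E assms(1) by (auto simp: input_graph_def)
    have "(i, m, D, j) \<notin> K" using x D I by (auto simp: Z_def)
    \<comment> \<open>The dimension never exceeds that of the space, so an edge outside
      \<open>K\<close> has exactly full dimension and is active.\<close>
    moreover have "dim (cols_cone D \<inter> mat_cone I) \<le> CARD('d)"
      using dim_subset_UNIV[of "cols_cone D \<inter> mat_cone I"] by simp
    ultimately have a: "(i, m, D, j) \<in> active_edges E i I"
      using E by (auto simp: active_edges_mem K_def)
    then have "decomposition \<N> ((\<lambda>x. matrix_inv m *v x) ` (cols_cone D \<inter> mat_cone I)) (\<J> (i, m, D, j))"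
      using dec by auto
    then have "(\<Union>J \<in> \<J> (i, m, D, j). mat_cone J) = (\<lambda>x. matrix_inv m *v x) ` (cols_cone D \<inter> mat_cone I)"
      by (simp add: decomposition_def)
    then have "matrix_inv m *v (I *v x) \<in> (\<Union>J \<in> \<J> (i, m, D, j). mat_cone J)"
      using D I by blast
    then obtain J where J: "J \<in> \<J> (i, m, D, j)" "matrix_inv m *v (I *v x) \<in> mat_cone J" by blast
    then have "x \<in> mat_cone (matrix_inv I ** m ** J)"
      by (simp add: mem_mat_cone_edge_iff inv assms(3))
    moreover have "((i, I), matrix_inv I ** m ** J, (j, J)) \<in> X" using X a J by blast
    ultimately show "\<exists>v M w. (v, M, w) \<in> X \<and> x \<in> mat_cone M" by blast
  qed
qed

text \<open>The outgoing cones cover the orthant almost everywhere and, being finitely many closed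
  sets, cover it entirely. Conversely the pieces \<open>J\<close> lie in the image under
  \<open>m^-1\<close> of the cone of \<open>I\<close>, so \<open>I\<close> sends each edge cone into
  the cone of \<open>I\<close>, and \<open>I\<close> cancels.\<close>

lemma expansion_orthant:
  fixes E :: "('v, 'd::finite) input_edge set"
  assumes "input_graph S E" "expansion E \<N> i I X" "invertible I"
    and cover: "mat_cone I \<subseteq> \<Union> {cols_cone D | m D j. (i, m, D, j) \<in> E}"
  shows "orthant = (\<Union>(v, M, w) \<in> X. mat_cone M)"
proof
  have inv: "invertible M" if "(v, M, w) \<in> X" for v M w
    using that expansion_edge[OF assms(1-3)] by (metis surj_pair)
  have "finite X" using finite_expansion assms(1,2) by (auto simp: input_graph_def)
  then have "closed (\<Union>(v, M, w) \<in> X. mat_cone M)"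
    by (intro closed_UN) (auto intro: closed_mat_cone inv)
  moreover have "AE x in lebesgue. x \<in> orthant \<longrightarrow> x \<in> (\<Union>(v, M, w) \<in> X. mat_cone M)"
    using expansion_covers[OF assms(1-3)]
  proof (rule eventually_mono, intro impI)
    fix x :: "real^'d"
    assume *: "x \<in> orthant \<longrightarrow> (\<forall>m D j. (i, m, D, j) \<in> E \<and> I *v x \<in> cols_cone D \<longrightarrow>
      (\<exists>v M w. (v, M, w) \<in> X \<and> x \<in> mat_cone M))" and x: "x \<in> orthant"
    have "I *v x \<in> mat_cone I" using x by (simp add: mat_cone_def)
    then obtain m D j where "(i, m, D, j) \<in> E" "I *v x \<in> cols_cone D" using cover by blast
    then show "x \<in> (\<Union>(v, M, w) \<in> X. mat_cone M)" using * x by blast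
  qed
  ultimately show "orthant \<subseteq> (\<Union>(v, M, w) \<in> X. mat_cone M)" by (rule orthant_subset_closed)
  show "(\<Union>(v, M, w) \<in> X. mat_cone M) \<subseteq> orthant"
  proof clarify
    fix x v M j J assume e: "(v, M, (j, J)) \<in> X" and x: "x \<in> mat_cone M"
    then obtain m D where M: "M = matrix_inv I ** m ** J" and "invertible m"
      and sub: "mat_cone J \<subseteq> (\<lambda>x. matrix_inv m *v x) ` (cols_cone D \<inter> mat_cone I)"
      using expansion_edge[OF assms(1-3) e] by metis
    then have "matrix_inv m *v (I *v x) \<in> mat_cone J"
      using x by (simp add: mem_mat_cone_edge_iff assms(3))
    then have "I *v x \<in> mat_cone I"
      using sub matrix_inv_vector_mem_image_iff[OF \<open>invertible m\<close>] by blast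
    then show "x \<in> orthant"
      using matrix_inv_vector_left[OF assms(3)] by (simp add: mem_mat_cone_iff assms(3))
  qed
qed

subsection \<open>Runs of the algorithm\<close>

text \<open>Pending vertices emit no edges, hence all edges leaving an expanded vertex stem from a
  single pass. The inclusion for \<open>V\<close> makes every vertex without incoming edge an
  initial one, which locates the vertices to be removed.\<close>

definition conv_invariant ::
  "'v set \<Rightarrow> ('v, 'd::finite) input_edge set \<Rightarrow> (real^'d^'d) set \<Rightarrow> ('v, 'd) conv_state \<Rightarrow> bool"
  where "conv_invariant S E \<N> = (\<lambda>(P, V, A).
    P \<subseteq> V \<and> finite V \<and> finite A \<and>
    (\<forall>i I. (i, I) \<in> V \<longrightarrow> i \<in> S \<and> invertible I \<and> nonneg_matrix I) \<and>
    (\<forall>v M w. (v, M, w) \<in> A \<longrightarrow> v \<in> V - P \<and> w \<in> V) \<and>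
    V \<subseteq> S \<times> {mat 1} \<union> {w. \<exists>v M. (v, M, w) \<in> A} \<and>
    (\<forall>i I. (i, I) \<in> V - P \<longrightarrow> expansion E \<N> i I {e \<in> A. fst e = (i, I)}))"

lemma conv_invariant_init:
  fixes E :: "('v, 'd::finite) input_edge set"
  assumes "input_graph S E"
  shows "conv_invariant S E \<N> (conv_init S)"
proof -
  have "nonneg_matrix (mat 1 :: real^'d^'d)" by (simp add: nonneg_matrix_def mat_def)
  moreover have "invertible (mat 1 :: real^'d^'d)"
    by (auto simp: invertible_def intro: exI[of _ "mat 1"])
  ultimately show ?thesis
    using assms by (auto simp: conv_invariant_def conv_init_def input_graph_def)
qed

text \<open>The withdrawn vertex has no outgoing edges yet, so afterwards its edges are exactly
  \<open>new\<close>; and only unseen targets are queued, so an expanded vertex is never expanded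
  again.\<close>

lemma conv_invariant_step:
  assumes g: "input_graph S E" and "conv_step E \<N> s s'" and "conv_invariant S E \<N> s"
  shows "conv_invariant S E \<N> s'"
  using assms(2,3)
proof cases
  case (1 i I P \<J> new T V A)
  have inv: "P \<subseteq> V" "finite V" "finite A"
    "\<And>i I. (i, I) \<in> V \<Longrightarrow> i \<in> S \<and> invertible I \<and> nonneg_matrix I"
    "\<And>v M w. (v, M, w) \<in> A \<Longrightarrow> v \<in> V \<and> v \<notin> P \<and> w \<in> V"
    "V \<subseteq> S \<times> {mat 1} \<union> {w. \<exists>v M. (v, M, w) \<in> A}"
    "\<And>i I. (i, I) \<in> V \<Longrightarrow> (i, I) \<notin> P \<Longrightarrow> expansion E \<N> i I {e \<in> A. fst e = (i, I)}"
    using assms(3) unfolding 1(1) conv_invariant_def by blast+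
  have ex: "expansion E \<N> i I new"
    unfolding expansion_def using 1(4,5) by blast
  have iI: "(i, I) \<in> V" using 1 inv by blast
  then have I: "invertible I" using inv(4) by blast
  have "finite new" using finite_expansion[OF _ ex] g by (simp add: input_graph_def)
  then have "finite T" using 1 by simp
  have new: "v = (i, I)" "w \<in> T" if "(v, M, w) \<in> new" for v M w
    using that unfolding 1(5,6) by force+
  have T: "\<exists>v M. (v, M, w) \<in> new" if "w \<in> T" for w
    using that unfolding 1(6) by force
  have T': "j \<in> S \<and> invertible J \<and> nonneg_matrix J" if "(j, J) \<in> T" for j J
    using T[OF that] expansion_edge[OF g ex I] by metis
  have no: "v \<noteq> (i, I)" if "(v, M, w) \<in> A" for v M w
    using inv(5)[OF that] 1(3) by blast
  \<comment> \<open>A loop at \<open>(i, I)\<close> does no harm: even if \<open>(i, I)\<close> lies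
    in \<open>T\<close>, it belongs to \<open>V\<close> and is not queued again.\<close>
  have "expansion E \<N> a B {e \<in> A \<union> new. fst e = (a, B)}"
    if ab: "(a, B) \<in> V \<union> T" "(a, B) \<notin> P - {(i, I)} \<union> (T - V)" for a B
  proof (cases "(a, B) = (i, I)")
    case True
    then have "{e \<in> A \<union> new. fst e = (a, B)} = new" using no new by fastforce
    then show ?thesis using ex True by simp
  next
    case False
    then have "{e \<in> A \<union> new. fst e = (a, B)} = {e \<in> A. fst e = (a, B)}" using new by fastforce
    then show ?thesis using inv(7) ab False by auto
  qed
  then have "\<forall>a B. (a, B) \<in> V \<union> T - (P - {(i, I)} \<union> (T - V)) \<longrightarrow>
      expansion E \<N> a B {e \<in> A \<union> new. fst e = (a, B)}" by simp
  moreover have "\<forall>v M w. (v, M, w) \<in> A \<union> new \<longrightarrow>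
      v \<in> V \<union> T - (P - {(i, I)} \<union> (T - V)) \<and> w \<in> V \<union> T"
  proof (intro allI impI)
    fix v M w assume "(v, M, w) \<in> A \<union> new"
    then consider "(v, M, w) \<in> A" | "(v, M, w) \<in> new" by blast
    then show "v \<in> V \<union> T - (P - {(i, I)} \<union> (T - V)) \<and> w \<in> V \<union> T"
      by cases (use inv(5)[of v M w] new[of v M w] iI in simp_all)
  qed
  moreover have "V \<union> T \<subseteq> S \<times> {mat 1} \<union> {w. \<exists>v M. (v, M, w) \<in> A \<union> new}"
    using inv(6) T by blast
  moreover have "P - {(i, I)} \<union> (T - V) \<subseteq> V \<union> T" using inv(1) by blast
  moreover have "\<forall>a B. (a, B) \<in> V \<union> T \<longrightarrow> a \<in> S \<and> invertible B \<and> nonneg_matrix B"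
    using inv(4) T' by blast
  moreover have "finite (V \<union> T)" "finite (A \<union> new)"
    using inv(2,3) \<open>finite new\<close> \<open>finite T\<close> by simp_all
  ultimately show ?thesis
    unfolding 1(2) conv_invariant_def prod.case by (intro conjI)
qed

lemma conversion_output_invariant:
  assumes "input_graph S E" "conversion_output S E \<N> V A"
  shows "conv_invariant S E \<N> ({}, V, A)"
  using assms(2) unfolding conversion_output_def
proof (induction rule: rtranclp_induct)
  case base
  show ?case by (rule conv_invariant_init[OF assms(1)])
next
  case (step s s')
  show ?case by (rule conv_invariant_step[OF assms(1) step.hyps(2) step.IH])
qed

subsection \<open>The conjugacy\<close>

text \<open>By definition the additional factor is applied last; the induction on \<open>n\<close>
  needs it applied first, so that it can split off one move of \<open>G\<close> along a known
  edge.\<close>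

lemma map_power_Suc: "map_power F (Suc n) = map_power F n \<circ>\<^sub>m F"
proof (induction n)
  case (Suc n)
  have "map_power F (Suc (Suc n)) = F \<circ>\<^sub>m map_power F (Suc n)" by (simp add: map_power_def)
  also have "\<dots> = (F \<circ>\<^sub>m map_power F n) \<circ>\<^sub>m F"
    unfolding Suc by (rule ext) (auto simp: map_comp_def split: option.splits)
  finally show ?case by (simp add: map_power_def)
qed (auto simp: map_power_def map_comp_def fun_eq_iff split: option.splits)

lemma input_branches_iff:
  "(i, m, C, j) \<in> input_branches E \<longleftrightarrow> (\<exists>D. (i, m, D, j) \<in> E \<and> C = cols_cone D)"
  by (force simp: input_branches_def)

lemma output_branches_iff:
  "(v, M, C, w) \<in> output_branches A \<longleftrightarrow> (v, M, w) \<in> A \<and> C = mat_cone M"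
  by (force simp: output_branches_def)

text \<open>The case \<open>n = 1\<close>. The second conjunct prepares the induction:
  \<open>G\<close> moves along some \<open>M^-1\<close> and stays in the orthant, so the exceptional
  sets of later iterates can be handled edge by edge.\<close>

lemma expansion_semiconj:
  fixes E :: "('v, 'd::finite) input_edge set"
  assumes g: "input_graph S E" and i: "i \<in> S" and I: "invertible I" "nonneg_matrix I"
    and ex: "expansion E \<N> i I {e \<in> A. fst e = (i, I)}" and V: "(i, I) \<in> V"
    and F: "cf_map S (input_branches E) F" and G: "cf_map V (output_branches A) G"
  shows "AE x in lebesgue. x \<in> orthant \<longrightarrow>
    F (phi (x, i, I)) = map_option phi (G (x, i, I)) \<and>
    (\<forall>y w. G (x, i, I) = Some (y, w) \<longrightarrow>
      (\<exists>M. ((i, I), M, w) \<in> A \<and> y = matrix_inv M *v x \<and> y \<in> orthant))"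
proof -
  have "AE y in lebesgue. y \<in> orthant \<longrightarrow>
    (\<forall>m C j. (i, m, C, j) \<in> input_branches E \<and> y \<in> C \<longrightarrow> F (y, i) = Some (matrix_inv m *v y, j)) \<and>
    ((\<nexists>m C j. (i, m, C, j) \<in> input_branches E \<and> y \<in> C) \<longrightarrow> F (y, i) = None)"
    using F i unfolding cf_map_def by blast
  \<comment> \<open>The exceptional set of \<open>F\<close> lives in the coordinates
    \<open>I x\<close>; its preimage under \<open>I\<close> is still null.\<close>
  from AE_lebesgue_matrix[OF I(1) this]
  have AF: "AE x in lebesgue. I *v x \<in> orthant \<longrightarrow>
    (\<forall>m D j. (i, m, D, j) \<in> E \<and> I *v x \<in> cols_cone D \<longrightarrow>
      F (I *v x, i) = Some (matrix_inv m *v (I *v x), j)) \<and>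
    ((\<nexists>m D j. (i, m, D, j) \<in> E \<and> I *v x \<in> cols_cone D) \<longrightarrow> F (I *v x, i) = None)"
    unfolding input_branches_iff by (rule eventually_mono) blast
  have "AE x in lebesgue. x \<in> orthant \<longrightarrow>
    (\<forall>M C w. ((i, I), M, C, w) \<in> output_branches A \<and> x \<in> C \<longrightarrow>
      G (x, i, I) = Some (matrix_inv M *v x, w)) \<and>
    ((\<nexists>M C w. ((i, I), M, C, w) \<in> output_branches A \<and> x \<in> C) \<longrightarrow> G (x, i, I) = None)"
    using G V unfolding cf_map_def by blast
  then have AG: "AE x in lebesgue. x \<in> orthant \<longrightarrow>
    (\<forall>M w. ((i, I), M, w) \<in> A \<and> x \<in> mat_cone M \<longrightarrow> G (x, i, I) = Some (matrix_inv M *v x, w)) \<and>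
    ((\<nexists>M w. ((i, I), M, w) \<in> A \<and> x \<in> mat_cone M) \<longrightarrow> G (x, i, I) = None)"
    unfolding output_branches_iff by (rule eventually_mono) blast
  show ?thesis
    using AF AG expansion_covers[OF g ex I(1)]
  proof eventually_elim
    case (elim x)
    show ?case
    proof
      assume x: "x \<in> orthant"
      have Ix: "I *v x \<in> orthant" by (rule nonneg_matrix_orthant[OF I(2) x])
      show "F (phi (x, i, I)) = map_option phi (G (x, i, I)) \<and>
        (\<forall>y w. G (x, i, I) = Some (y, w) \<longrightarrow>
          (\<exists>M. ((i, I), M, w) \<in> A \<and> y = matrix_inv M *v x \<and> y \<in> orthant))"
      proof (cases "\<exists>M j J. ((i, I), M, (j, J)) \<in> A \<and> x \<in> mat_cone M")
        case True
        then obtain M j J where e: "((i, I), M, (j, J)) \<in> A" "x \<in> mat_cone M" by blast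
        then have e': "((i, I), M, (j, J)) \<in> {e \<in> A. fst e = (i, I)}" by simp
        obtain m D where mD: "(i, m, D, j) \<in> E" "I *v x \<in> cols_cone D"
          "J *v (matrix_inv M *v x) = matrix_inv m *v (I *v x)"
          by (rule expansion_edge_value[OF g ex I(1) e' e(2)])
        have "invertible M"
          by (rule expansion_edge[OF g ex I(1) e'])
        then have "matrix_inv M *v x \<in> orthant"
          using e by (simp add: mem_mat_cone_iff)
        moreover have "G (x, i, I) = Some (matrix_inv M *v x, (j, J))"
          using elim(2) x e by blast
        moreover have "F (I *v x, i) = Some (matrix_inv m *v (I *v x), j)"
          using elim(1) Ix mD by blast
        ultimately show ?thesis using e mD by (auto simp: phi_def)
      next
        case False
        \<comment> \<open>Outside all edge cones, \<open>expansion_covers\<close> keeps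
          \<open>I x\<close> out of every input cone at \<open>i\<close>, so both maps are
          undefined. This gives the equality of domains.\<close>
        then have "G (x, i, I) = None" using elim(2) x by fastforce
        moreover have "\<nexists>m D j. (i, m, D, j) \<in> E \<and> I *v x \<in> cols_cone D"
          using elim(3) x False by fastforce
        then have "F (I *v x, i) = None" using elim(1) Ix by blast
        ultimately show ?thesis by (simp add: phi_def)
      qed
    qed
  qed
qed

section \<open>Assembly: disjointness, conjugacy and the matrices graph\<close>

theorem proposition4p2:
  fixes S :: "'v set"
    and E :: "('v, 'd::finite) input_edge set"
    and \<N> :: "(real^'d^'d) set"
    and V :: "('v \<times> (real^'d^'d)) set"
    and A :: "('v \<times> (real^'d^'d), 'd) edge set"
  assumes "input_graph S E"
    and "normalization \<N>"
    and "conversion_output S E \<N> V A"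
  shows "(\<forall>v \<in> V.
        pairwise (\<lambda>(_, M, _) (_, M', _). lebesgue_disjoint (mat_cone M) (mat_cone M'))
          {e \<in> A. fst e = v})
    \<and> (\<forall>F G. cf_map S (input_branches E) F \<longrightarrow> cf_map V (output_branches A) G \<longrightarrow>
        (\<forall>n. \<forall>(i, I) \<in> V. AE x in lebesgue. x \<in> orthant \<longrightarrow>
          map_power F n (phi (x, i, I)) = map_option phi (map_power G n (x, i, I))))
    \<and> (covering_input_graph E \<longrightarrow>
        (\<exists>R \<subseteq> S \<times> {mat 1}.
          (\<forall>(v, M, w) \<in> A. w \<notin> R) \<and>
          matrices_graph (V - R) {(v, M, w) \<in> A. v \<notin> R \<and> w \<notin> R}))"
proof -
  note g = assms(1)
  have "conv_invariant S E \<N> ({}, V, A)"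
    by (rule conversion_output_invariant[OF assms(1,3)])
  then have fin: "finite V" "finite A"
    and vert: "\<And>i I. (i, I) \<in> V \<Longrightarrow> i \<in> S \<and> invertible I \<and> nonneg_matrix I"
    and edge: "\<And>v M w. (v, M, w) \<in> A \<Longrightarrow> v \<in> V \<and> w \<in> V"
    and target: "V \<subseteq> S \<times> {mat 1} \<union> {w. \<exists>v M. (v, M, w) \<in> A}"
    and ex: "\<And>i I. (i, I) \<in> V \<Longrightarrow> expansion E \<N> i I {e \<in> A. fst e = (i, I)}"
    unfolding conv_invariant_def by blast+
  have edge_inv: "invertible M" if "(v, M, w) \<in> A" for v M w
  proof -
    obtain i I j J where v: "v = (i, I)" "w = (j, J)" by (metis surj_pair)
    have "(i, I) \<in> V" using edge[OF that] v by simp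
    moreover have "(v, M, (j, J)) \<in> {e \<in> A. fst e = (i, I)}" using that v by simp
    ultimately show ?thesis using vert expansion_edge[OF g ex] by blast
  qed
  have disj: "pairwise (\<lambda>(_, M, _) (_, M', _). lebesgue_disjoint (mat_cone M) (mat_cone M'))
      {e \<in> A. fst e = v}" if "v \<in> V" for v
  proof -
    obtain i I where v: "v = (i, I)" by (metis surj_pair)
    then show ?thesis using that vert[of i I] expansion_disjoint[OF g _ ex, of i I] by simp
  qed

  \<comment> \<open>Conjugacy of all iterates\<close>
  have conj: "\<forall>(i, I) \<in> V. AE x in lebesgue. x \<in> orthant \<longrightarrow>
      map_power F n (phi (x, i, I)) = map_option phi (map_power G n (x, i, I))"
    if F: "cf_map S (input_branches E) F" and G: "cf_map V (output_branches A) G" for F G n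
  proof (induction n)
    case (Suc n)
    show ?case
    proof clarify
      fix i I assume iI: "(i, I) \<in> V"
      \<comment> \<open>\<open>G\<close> may leave along any edge, so the induction hypothesis is
        pulled back along all edges at once; \<open>A\<close> is finite, so the exceptional set
        stays null.\<close>
      have "AE x in lebesgue. \<forall>e \<in> A. matrix_inv (fst (snd e)) *v x \<in> orthant \<longrightarrow>
        map_power F n (phi (matrix_inv (fst (snd e)) *v x, snd (snd e))) =
        map_option phi (map_power G n (matrix_inv (fst (snd e)) *v x, snd (snd e)))"
      proof (rule AE_finite_allI[OF fin(2)])
        fix e assume "e \<in> A"
        obtain v M j J where e: "e = (v, M, (j, J))" by (metis surj_pair)
        have M: "invertible (matrix_inv M)"
          using \<open>e \<in> A\<close> e edge_inv invertible_matrix_inv by blast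
        have "(j, J) \<in> V" using \<open>e \<in> A\<close> e edge by blast
        then have "AE y in lebesgue. y \<in> orthant \<longrightarrow>
            map_power F n (phi (y, j, J)) = map_option phi (map_power G n (y, j, J))"
          using Suc by auto
        from AE_lebesgue_matrix[OF M this]
        show "AE x in lebesgue. matrix_inv (fst (snd e)) *v x \<in> orthant \<longrightarrow>
          map_power F n (phi (matrix_inv (fst (snd e)) *v x, snd (snd e))) =
          map_option phi (map_power G n (matrix_inv (fst (snd e)) *v x, snd (snd e)))"
          by (simp add: e)
      qed
      moreover have "AE x in lebesgue. x \<in> orthant \<longrightarrow>
          F (phi (x, i, I)) = map_option phi (G (x, i, I)) \<and>
          (\<forall>y w. G (x, i, I) = Some (y, w) \<longrightarrow>
            (\<exists>M. ((i, I), M, w) \<in> A \<and> y = matrix_inv M *v x \<and> y \<in> orthant))"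
        using vert[OF iI] by (intro expansion_semiconj[OF g _ _ _ ex[OF iI] iI F G]) auto
      ultimately show "AE x in lebesgue. x \<in> orthant \<longrightarrow>
          map_power F (Suc n) (phi (x, i, I)) = map_option phi (map_power G (Suc n) (x, i, I))"
      proof eventually_elim
        case (elim x)
        show ?case
        proof
          assume x: "x \<in> orthant"
          show "map_power F (Suc n) (phi (x, i, I)) = map_option phi (map_power G (Suc n) (x, i, I))"
          proof (cases "G (x, i, I)")
            case None
            \<comment> \<open>\<open>F\<close> is then undefined at the image under
              \<open>phi\<close>, so both powers are \<open>None\<close>.\<close>
            then show ?thesis using elim(2) x by (simp add: map_power_Suc map_comp_def)
          next
            case (Some z)
            obtain y w where z: "z = (y, w)" by (metis surj_pair)
            then obtain M where M: "((i, I), M, w) \<in> A" "y = matrix_inv M *v x" "y \<in> orthant"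
              using elim(2) x Some by blast
            have "map_power F n (phi (y, w)) = map_option phi (map_power G n (y, w))"
              using bspec[OF elim(1) M(1)] M by simp
            then show ?thesis using elim(2) x Some z by (simp add: map_power_Suc map_comp_def)
          qed
        qed
      qed
    qed
  qed (simp add: map_power_def)

  \<comment> \<open>The matrices graph under the covering hypothesis\<close>
  have "\<exists>R \<subseteq> S \<times> {mat 1}. (\<forall>(v, M, w) \<in> A. w \<notin> R) \<and>
      matrices_graph (V - R) {(v, M, w) \<in> A. v \<notin> R \<and> w \<notin> R}" if cov: "covering_input_graph E"
  proof -
    \<comment> \<open>The covering hypothesis only concerns vertices reached by an edge, so an
      initial vertex without incoming edge may have an orthant that is not covered. No edge ends in
      \<open>R\<close>, so the remaining vertices keep all their outgoing edges and one round of
      removal suffices.\<close>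
    define R where "R = {w \<in> S \<times> {mat 1}. \<nexists>v M. (v, M, w) \<in> A}"
    define A' where "A' = {(v, M, w) \<in> A. v \<notin> R \<and> w \<notin> R}"
    have R: "w \<notin> R" if "(v, M, w) \<in> A" for v M w using that unfolding R_def by blast
    have A': "(v, M, w) \<in> A' \<longleftrightarrow> (v, M, w) \<in> A \<and> v \<notin> R" for v M w
      using R[of v M w] by (auto simp: A'_def)
    have lab: "labels A' v = (\<lambda>(_, M, _). M) ` {e \<in> A. fst e = v}" if "v \<notin> R" for v
    proof (intro set_eqI iffI)
      fix M assume "M \<in> labels A' v"
      then obtain w where "(v, M, w) \<in> A" unfolding labels_def A' by blast
      then show "M \<in> (\<lambda>(_, M, _). M) ` {e \<in> A. fst e = v}"
        by (intro image_eqI[of _ _ "(v, M, w)"]) simp_all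
    next
      fix M assume "M \<in> (\<lambda>(_, M, _). M) ` {e \<in> A. fst e = v}"
      then obtain w where "(v, M, w) \<in> A" by auto
      then show "M \<in> labels A' v" using that unfolding labels_def A' by blast
    qed
    \<comment> \<open>Otherwise the cone of \<open>M\<close> would be Lebesgue-disjoint from itself,
      hence null.\<close>
    have det: "t = t'" if "(v, M, t) \<in> A" "(v, M, t') \<in> A" for v M t t'
    proof (rule ccontr)
      assume "t \<noteq> t'"
      have "v \<in> V" using that edge by blast
      from pairwiseD[OF disj[OF this], of "(v, M, t)" "(v, M, t')"] \<open>t \<noteq> t'\<close> that
      have "negligible (mat_cone M)" by (simp add: lebesgue_disjoint_iff_negligible)
      then show False using mat_cone_not_negligible edge_inv that by blast
    qed
    have orth: "orthant = (\<Union>m \<in> labels A' v. mat_cone m)" if v: "v \<in> V - R" for v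
    proof -
      obtain i I where iI: "v = (i, I)" by (metis surj_pair)
      \<comment> \<open>The incoming edge is sought in \<open>A\<close>, not in \<open>A'\<close>:
        its source may lie in \<open>R\<close>, as only the input edge behind it matters.\<close>
      obtain u N where uN: "(u, N, (i, I)) \<in> A"
        using v target iI by (auto simp: R_def)
      obtain k K where u: "u = (k, K)" by (metis surj_pair)
      have kK: "(k, K) \<in> V" "invertible K" using edge[OF uN] vert u by auto
      have "(u, N, (i, I)) \<in> {e \<in> A. fst e = (k, K)}" using uN u by simp
      then obtain m D where mD: "(k, m, D, i) \<in> E"
        "mat_cone I \<subseteq> (\<lambda>x. matrix_inv m *v x) ` (cols_cone D \<inter> mat_cone K)"
        by (rule expansion_edge[OF g ex[OF kK(1)] kK(2)])
      have "(\<lambda>x. matrix_inv m *v x) ` cols_cone D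
          \<subseteq> \<Union> {cols_cone D' | m' D' k. (i, m', D', k) \<in> E}"
        using bspec[OF cov[unfolded covering_input_graph_def] mD(1)] unfolding prod.case .
      \<comment> \<open>The cone of \<open>I\<close> lies in \<open>m^-1 D\<close>, which the
        covering hypothesis for this input edge puts inside the cones available at
        \<open>i\<close>.\<close>
      from order_trans[OF mD(2) order_trans[OF image_mono[OF Int_lower1] this]]
      have "mat_cone I \<subseteq> \<Union> {cols_cone D' | m' D' k. (i, m', D', k) \<in> E}" .
      moreover have "(i, I) \<in> V" "invertible I" using v iI vert[of i I] by simp_all
      ultimately have "orthant = (\<Union>(v, M, w) \<in> {e \<in> A. fst e = (i, I)}. mat_cone M)"
        by (intro expansion_orthant[OF g ex])
      then show ?thesis using v iI by (simp add: lab image_image case_prod_beta)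
    qed
    have "pairwise (\<lambda>m m'. lebesgue_disjoint (mat_cone m) (mat_cone m')) (labels A' v)"
      if v: "v \<in> V - R" for v
    proof (rule pairwiseI)
      fix m m' assume "m \<in> labels A' v" "m' \<in> labels A' v" and ne: "m \<noteq> m'"
      then obtain w w' where "(v, m, w) \<in> A" "(v, m', w') \<in> A" unfolding labels_def A' by blast
      then show "lebesgue_disjoint (mat_cone m) (mat_cone m')"
        using pairwiseD[OF disj[of v], of "(v, m, w)" "(v, m', w')"] v ne by simp
    qed
    moreover have "finite A'" by (rule finite_subset[OF _ fin(2)]) (use A' in auto)
    moreover have "\<forall>(v, M, w) \<in> A'. v \<in> V - R \<and> w \<in> V - R \<and> invertible M"
    proof
      fix e assume e: "e \<in> A'"
      obtain v M w where "e = (v, M, w)" by (rule prod_cases3)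
      with e show "case e of (v, M, w) \<Rightarrow> v \<in> V - R \<and> w \<in> V - R \<and> invertible M"
        using edge[of v M w] edge_inv[of v M w] R[of v M w] by (simp add: A')
    qed
    moreover have "\<forall>M t t'. (v, M, t) \<in> A' \<and> (v, M, t') \<in> A' \<longrightarrow> t = t'" for v
      using det unfolding A' by blast
    ultimately have "matrices_graph (V - R) A'"
      unfolding matrices_graph_def using orth finite_Diff[OF fin(1), of R]
      by (intro conjI) (assumption | (intro ballI conjI; assumption))+
    moreover have "R \<subseteq> S \<times> {mat 1}" unfolding R_def by blast
    moreover have "\<forall>(v, M, w) \<in> A. w \<notin> R" by (auto simp: R_def)
    ultimately show ?thesis
      by (intro exI[of _ R] conjI) (simp_all only: A'_def)
  qed
  note graph = this
  show ?thesis
    by (intro conjI; (intro ballI disj | intro impI graph | intro allI impI conj))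
qed

end
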